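(* Let $\alpha,\beta,\eta\in\mathbb{C}$. (1)(i) For $TSV(a,b)$ with $(a,b)\neq(1,0)$ and $\alpha\neq0$, a nontrivial extension $0\to M_{\alpha,\beta}\to E\to\mathbb{C}c_\eta\to0$ exists iff $\beta+\eta=0$ and $\alpha=1$. In this case $\dim\mathrm{Ext}(\mathbb{C}c_{-\beta},M_{1,\beta})=1$ and every nontrivial extension is equivalent to $E=\mathbb{C}[\partial]v\oplus\mathbb{C}c_\eta$ with $L_\lambda c_\eta=kv$, $Y_\lambda c_\eta=M_\lambda c_\eta=0$, $\partial c_\eta=\eta c_\eta+kv$ for some $k\neq0$. (1)(ii) For $TSV(1,0)$ and $(\alpha,\gamma)\neq(0,0)$, a nontrivial extension $0\to M_{\alpha,\beta,\gamma}\to E\to\mathbb{C}c_\eta\to0$ exists iff $\beta+\eta=0$ and $(\alpha,\gamma)=(1,0)$. In this case $\dim\mathrm{Ext}(\mathbb{C}c_{-\beta},M_{1,\beta,0})=1$ and every nontrivial extension is equivalent to the one with $L_\lambda c_\eta=kv$, $Y_\lambda c_\eta=M_\lambda c_\eta=0$, $\partial c_\eta=\eta c_\eta+kv$ for some $k\neq0$. (2) For $TSV(c)$ and $\alpha\neq0$, a nontrivial extension $0\to M_{\alpha,\beta}\to E\to\mathbb{C}c_\eta\to0$ exists iff $\beta+\eta=0$ and $\alpha=1$. In this case $\dim\mathrm{Ext}(\mathbb{C}c_{-\beta},M_{1,\beta})=1$ and every nontrivial extension is equivalent to the one with $L_\lambda c_\eta=kv$, $Y_\lambda c_\eta=M_\lambda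 c_\eta=0$, $\partial c_\eta=\eta c_\eta+kv$ for some $k\neq0$.
   Context: A conformal module over a Lie conformal algebra $\mathcal{R}$ is a $\mathbb{C}[\partial]$-module $V$ with $\mathbb{C}$-linear maps $a\otimes v\mapsto a_\lambda v\in V[\lambda]$ such that $(\partial a)_\lambda v=-\lambda a_\lambda v$, $a_\lambda(\partial v)=(\partial+\lambda)a_\lambda v$, and $a_\lambda(b_\mu v)-b_\mu(a_\lambda v)=[a_\lambda b]_{\lambda+\mu}v$. $TSV(a,b)$ ($a,b\in\mathbb{C}$) is the free $\mathbb{C}[\partial]$-module on $L,Y,M$ with $[L_\lambda L]=(\partial+2\lambda)L$, $[L_\lambda Y]=(\partial+a\lambda+b)Y$, $[L_\lambda M]=(\partial+2(a-1)\lambda+2b)M$, $[Y_\lambda Y]=(\partial+2\lambda)M$, $[Y_\lambda M]=[M_\lambda M]=0$. $TSV(c)$ ($c\in\mathbb{C}$) is the free $\mathbb{C}[\partial]$-module on $L,Y,M$ with $[L_\lambda L]=(\partial+2\lambda)L$, $[L_\lambda Y]=(\partial+\frac32\lambda+c)Y$, $[L_\lambda M]=(\partial+2c)M$, $[Y_\lambda Y]=(\partial+2\lambda)(-\partial-2c)M$, $[Y_\lambda M]=[M_\lambda M]=0$. For $TSV(a,b)$ with $(a,b)\neq(1,0)$ and for $TSV(c)$, $M_{\alpha,\beta}=\mathbb{C}[\partial]v$ ($\alpha\neq0$) has $L_\lambda v=(\partial+\alpha\lambda+\beta)v$, $Y_\lambda v=M_\lambda v=0$. For $TSV(1,0)$,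 $M_{\alpha,\beta,\gamma}=\mathbb{C}[\partial]v$ ($(\alpha,\gamma)\neq(0,0)$) has $L_\lambda v=(\partial+\alpha\lambda+\beta)v$, $Y_\lambda v=\gamma v$, $M_\lambda v=0$. $\mathbb{C}c_\eta$ is the one-dimensional module with $\partial c_\eta=\eta c_\eta$ and all $\lambda$-actions zero. An extension $0\to V\to E\to W\to0$ is an exact sequence of modules; equivalence means a module homomorphism between middle terms compatible with the identities on the end terms; trivial means equivalent to the direct sum extension; $\mathrm{Ext}(W,V)$ is the vector space of equivalence classes of extensions of $W$ by $V$. *)

theory Defs
  imports "HOL-Computational_Algebra.Polynomial" "HOL-Library.Product_Plus"
begin

text \<open>The three algebras are free C[d]-modules on generators L, Y, M.\<close>
datatype gen = Lg | Yg | Mg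

text \<open>Elements of V[lambda]
  are represented by their evaluations at all lambda, together with the requirement
  that they are polynomial in lambda.\<close>
record 'v cmod =
  smul :: "complex \<Rightarrow> 'v \<Rightarrow> 'v"
  dop  :: "'v \<Rightarrow> 'v"
  lact :: "gen \<Rightarrow> complex \<Rightarrow> 'v \<Rightarrow> 'v"

text \<open>A lambda-bracket of generators: if [X_l Z] = sum_G p_G(d,l) G then
  br X Z l n G = p_G(-n, l), i.e. the coefficient with d replaced by -n, which is
  how it acts when applied with parameter n: (p(d,l) G)_n w = p(-n,l) G_n w.\<close>
type_synonym bracket = "gen \<Rightarrow> gen \<Rightarrow> complex \<Rightarrow> complex \<Rightarrow> gen \<Rightarrow> complex"

fun gen_rank :: "gen \<Rightarrow> nat" where
  "gen_rank Lg = 0" | "gen_rank Yg = 1" | "gen_rank Mg = 2"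

text \<open>Extend brackets given for pairs (X,Z) with rank X <= rank Z to all pairs by
  skew-symmetry [Z_m X] = -[X_{-m-d} Z].\<close>
definition skew_extend :: "bracket \<Rightarrow> bracket" where
  "skew_extend base X Z l n G =
     (if gen_rank X \<le> gen_rank Z then base X Z l n G else - base Z X (n - l) n G)"

definition tsv_ab_base :: "complex \<Rightarrow> complex \<Rightarrow> bracket" where
  "tsv_ab_base a b X Z l n G =
    (case (X, Z) of
       (Lg, Lg) \<Rightarrow> (if G = Lg then - n + 2 * l else 0)
     | (Lg, Yg) \<Rightarrow> (if G = Yg then - n + a * l + b else 0)
     | (Lg, Mg) \<Rightarrow> (if G = Mg then - n + 2 * (a - 1) * l + 2 * b else 0)
     | (Yg, Yg) \<Rightarrow> (if G = Mg then - n + 2 * l else 0)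
     | _ \<Rightarrow> 0)"

definition TSV_ab :: "complex \<Rightarrow> complex \<Rightarrow> bracket" where
  "TSV_ab a b = skew_extend (tsv_ab_base a b)"

definition tsv_c_base :: "complex \<Rightarrow> bracket" where
  "tsv_c_base c X Z l n G =
    (case (X, Z) of
       (Lg, Lg) \<Rightarrow> (if G = Lg then - n + 2 * l else 0)
     | (Lg, Yg) \<Rightarrow> (if G = Yg then - n + 3 / 2 * l + c else 0)
     | (Lg, Mg) \<Rightarrow> (if G = Mg then - n + 2 * c else 0)
     | (Yg, Yg) \<Rightarrow> (if G = Mg then (- n + 2 * l) * (n - 2 * c) else 0)
     | _ \<Rightarrow> 0)"

definition TSV_c :: "complex \<Rightarrow> bracket" where
  "TSV_c c = skew_extend (tsv_c_base c)"

definition vec_space :: "('v::ab_group_add) cmod \<Rightarrow> bool" where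
  "vec_space V \<longleftrightarrow>
     (\<forall>a x y. smul V a (x + y) = smul V a x + smul V a y) \<and>
     (\<forall>a b x. smul V (a + b) x = smul V a x + smul V b x) \<and>
     (\<forall>a b x. smul V a (smul V b x) = smul V (a * b) x) \<and>
     (\<forall>x. smul V 1 x = x)"

definition clin :: "('v::ab_group_add) cmod \<Rightarrow> ('w::ab_group_add) cmod \<Rightarrow> ('v \<Rightarrow> 'w) \<Rightarrow> bool" where
  "clin V W f \<longleftrightarrow> (\<forall>x y. f (x + y) = f x + f y) \<and> (\<forall>a x. f (smul V a x) = smul W a (f x))"

definition poly_in_lambda :: "('v::ab_group_add) cmod \<Rightarrow> (complex \<Rightarrow> 'v) \<Rightarrow> bool" where
  "poly_in_lambda V h \<longleftrightarrow> (\<exists>(n::nat) c. \<forall>l. h l = (\<Sum>i\<le>n. smul V (l ^ i) (c i)))"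

text \<open>Conformal module over the algebra with bracket br (actions of generators;
  the action of a general element p(d)X is p(-l) X_l, which builds in (d a)_l = -l a_l).\<close>
definition conf_module :: "bracket \<Rightarrow> ('v::ab_group_add) cmod \<Rightarrow> bool" where
  "conf_module br V \<longleftrightarrow>
     vec_space V \<and> clin V V (dop V) \<and> (\<forall>X l. clin V V (lact V X l)) \<and>
     (\<forall>X w. poly_in_lambda V (\<lambda>l. lact V X l w)) \<and>
     (\<forall>X l w. lact V X l (dop V w) = dop V (lact V X l w) + smul V l (lact V X l w)) \<and>
     (\<forall>X Z l m w.
        lact V X l (lact V Z m w) - lact V Z m (lact V X l w) =
          smul V (br X Z l (l + m) Lg) (lact V Lg (l + m) w) +
          smul V (br X Z l (l + m) Yg) (lact V Yg (l + m) w) +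
          smul V (br X Z l (l + m) Mg) (lact V Mg (l + m) w))"

definition chom :: "('v::ab_group_add) cmod \<Rightarrow> ('w::ab_group_add) cmod \<Rightarrow> ('v \<Rightarrow> 'w) \<Rightarrow> bool" where
  "chom V W f \<longleftrightarrow> clin V W f \<and> (\<forall>w. f (dop V w) = dop W (f w)) \<and>
     (\<forall>X l w. f (lact V X l w) = lact W X l (f w))"

definition is_ext :: "bracket \<Rightarrow> ('v::ab_group_add) cmod \<Rightarrow> ('w::ab_group_add) cmod \<Rightarrow>
    ('e::ab_group_add) cmod \<Rightarrow> ('v \<Rightarrow> 'e) \<Rightarrow> ('e \<Rightarrow> 'w) \<Rightarrow> bool" where
  "is_ext br V W E i p \<longleftrightarrow> conf_module br E \<and> chom V E i \<and> chom E W p \<and>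
     inj i \<and> surj p \<and> range i = {x. p x = 0}"

definition ext_equiv :: "('e::ab_group_add) cmod \<Rightarrow> ('v \<Rightarrow> 'e) \<Rightarrow> ('e \<Rightarrow> 'w) \<Rightarrow>
    ('f::ab_group_add) cmod \<Rightarrow> ('v \<Rightarrow> 'f) \<Rightarrow> ('f \<Rightarrow> 'w) \<Rightarrow> bool" where
  "ext_equiv E i p F j q \<longleftrightarrow>
     (\<exists>\<phi>. chom E F \<phi> \<and> (\<forall>x. \<phi> (i x) = j x) \<and> (\<forall>y. q (\<phi> y) = p y))"

definition dsum :: "('v::ab_group_add) cmod \<Rightarrow> ('w::ab_group_add) cmod \<Rightarrow> ('v \<times> 'w) cmod" where
  "dsum V W = \<lparr> smul = (\<lambda>a (x, y). (smul V a x, smul W a y)),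
                dop = (\<lambda>(x, y). (dop V x, dop W y)),
                lact = (\<lambda>X l (x, y). (lact V X l x, lact W X l y)) \<rparr>"

definition trivial_ext :: "('v::ab_group_add) cmod \<Rightarrow> ('w::ab_group_add) cmod \<Rightarrow>
    ('e::ab_group_add) cmod \<Rightarrow> ('v \<Rightarrow> 'e) \<Rightarrow> ('e \<Rightarrow> 'w) \<Rightarrow> bool" where
  "trivial_ext V W E i p \<longleftrightarrow> ext_equiv E i p (dsum V W) (\<lambda>x. (x, 0)) snd"

text \<open>M_{alpha,beta,gamma} = C[d]v, an element p(d)v is represented by the polynomial p.
  L_l v = (d + alpha l + beta) v, Y_l v = gamma v, M_l v = 0.
  M_{alpha,beta} is the case gamma = 0.\<close>
definition Mmod :: "complex \<Rightarrow> complex \<Rightarrow> complex \<Rightarrow> complex poly cmod" where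
  "Mmod \<alpha> \<beta> \<gamma> = \<lparr> smul = smult, dop = pCons 0,
     lact = (\<lambda>X l p. case X of
               Lg \<Rightarrow> pcompose p [:l, 1:] * [:\<alpha> * l + \<beta>, 1:]
             | Yg \<Rightarrow> smult \<gamma> (pcompose p [:l, 1:])
             | Mg \<Rightarrow> 0) \<rparr>"

definition Cmod :: "complex \<Rightarrow> complex cmod" where
  "Cmod \<eta> = \<lparr> smul = (*), dop = (\<lambda>x. \<eta> * x), lact = (\<lambda>X l x. 0) \<rparr>"

text \<open>E = C[d]v (+) C c_eta with d c_eta = eta c_eta + k v, L_l c_eta = k v,
  Y_l c_eta = M_l c_eta = 0; (p, x) stands for p(d)v + x c_eta.\<close>
definition Ek :: "complex \<Rightarrow> complex \<Rightarrow> complex \<Rightarrow> complex \<Rightarrow> complex \<Rightarrow> (complex poly \<times> complex) cmod" where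
  "Ek \<alpha> \<beta> \<gamma> \<eta> k = \<lparr> smul = (\<lambda>a (p, x). (smult a p, a * x)),
     dop = (\<lambda>(p, x). (pCons 0 p + [:k * x:], \<eta> * x)),
     lact = (\<lambda>X l (p, x). case X of
               Lg \<Rightarrow> (pcompose p [:l, 1:] * [:\<alpha> * l + \<beta>, 1:] + [:k * x:], 0)
             | Yg \<Rightarrow> (smult \<gamma> (pcompose p [:l, 1:]), 0)
             | Mg \<Rightarrow> (0, 0)) \<rparr>"

definition incl :: "complex poly \<Rightarrow> complex poly \<times> complex" where
  "incl p = (p, 0)"

end

theory Submission
  imports Defs
begin

text \<open>Let \<open>c\<close> be a preimage of \<open>c\<^sub>\<eta>\<close> in an extension \<open>E\<close> of \<open>\<complex>c\<^sub>\<eta>\<close> by \<open>M = \<complex>[\<partial>]v\<close>.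
  Then \<open>\<partial>c - \<eta>c = f(\<partial>)v\<close>, and replacing \<open>c\<close> by \<open>c - q(\<partial>)v\<close>, where \<open>f = (\<partial> - \<eta>)q + k\<close>,
  achieves \<open>\<partial>c = \<eta>c + kv\<close> with a constant \<open>k\<close>.  Each \<open>X\<^sub>\<lambda>c\<close> lies in \<open>M\<close>, and
  \<open>X\<^sub>\<lambda>\<partial> = (\<partial> + \<lambda>)X\<^sub>\<lambda>\<close> gives \<open>(\<partial> + \<lambda> - \<eta>)X\<^sub>\<lambda>c = X\<^sub>\<lambda>(kv)\<close>.  So \<open>X\<^sub>\<lambda>(kv)\<close> vanishes at
  \<open>\<partial> = \<eta> - \<lambda>\<close>, which for \<open>k \<noteq> 0\<close> forces \<open>\<alpha> = 1\<close>, \<open>\<beta> + \<eta> = 0\<close>, \<open>\<gamma> = 0\<close>; cancelling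
  \<open>\<partial> + \<lambda> - \<eta>\<close> then gives \<open>L\<^sub>\<lambda>c = kv\<close> and \<open>Y\<^sub>\<lambda>c = M\<^sub>\<lambda>c = 0\<close>.  Hence
  \<open>e \<mapsto> (e - p(e)c, p(e))\<close> is an equivalence of \<open>E\<close> with \<open>E\<^sub>k\<close>.  The \<open>E\<^sub>k\<close> are pairwise
  inequivalent, and \<open>E\<^sub>0\<close> is the split extension.\<close>

definition poly_family :: "(complex \<Rightarrow> complex poly) \<Rightarrow> bool" where
  "poly_family h \<longleftrightarrow> (\<exists>Q :: complex poly poly. \<forall>l. h l = poly Q [:l:])"

lemma const_power_mult: "[:l:] ^ i * q = smult (l ^ i) (q :: complex poly)"
  by (induct i) (auto simp: smult_conv_map_poly[symmetric] mult.assoc)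

lemma poly_const_eq_sum:
  "poly (Q :: complex poly poly) [:l:] = (\<Sum>i\<le>degree Q. smult (l ^ i) (coeff Q i))"
  unfolding poly_altdef by (rule sum.cong) (simp_all add: const_power_mult[symmetric] mult.commute)

lemma poly_family_const: "poly_family (\<lambda>l. q)"
  unfolding poly_family_def by (rule exI[of _ "[:q:]"]) simp

lemma poly_family_add: "poly_family f \<Longrightarrow> poly_family g \<Longrightarrow> poly_family (\<lambda>l. f l + g l)"
  unfolding poly_family_def by (metis poly_add)

lemma poly_family_mult: "poly_family f \<Longrightarrow> poly_family g \<Longrightarrow> poly_family (\<lambda>l. f l * g l)"
  unfolding poly_family_def by (metis poly_mult)

lemma poly_family_linear: "poly_family (\<lambda>l. [:a * l + b, 1:])"
  unfolding poly_family_def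
  by (rule exI[of _ "[:[:b, 1:], [:a:]:]"]) (simp add: algebra_simps)

lemma poly_family_pcompose_shift: "poly_family (\<lambda>l. pcompose q [:l, 1:])"
proof (induct q)
  case 0
  show ?case using poly_family_const[of 0] by simp
next
  case (pCons a q)
  show ?case unfolding pcompose_pCons
    using poly_family_linear[of 1 0]
    by (intro poly_family_add poly_family_mult poly_family_const pCons(2)) simp
qed

text \<open>With \<open>\<gamma> = 0\<close> only \<open>L\<close> acts nontrivially on \<open>E\<^sub>k\<close>, so the commutator axiom for
  \<open>E\<^sub>k\<close> involves only the \<open>L\<close>-coefficients of the brackets.\<close>
definition L_coeff_virasoro :: "bracket \<Rightarrow> bool" where
  "L_coeff_virasoro br \<longleftrightarrow>
     (\<forall>l n. br Lg Lg l n Lg = - n + 2 * l) \<and>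
     (\<forall>X Z l n. (X, Z) \<noteq> (Lg, Lg) \<longrightarrow> br X Z l n Lg = 0)"

lemma L_coeff_virasoro_TSV_ab: "L_coeff_virasoro (TSV_ab a b)"
  unfolding L_coeff_virasoro_def
  by (auto simp: TSV_ab_def skew_extend_def tsv_ab_base_def split: gen.splits)

lemma L_coeff_virasoro_TSV_c: "L_coeff_virasoro (TSV_c c)"
  unfolding L_coeff_virasoro_def
  by (auto simp: TSV_c_def skew_extend_def tsv_c_base_def split: gen.splits)

definition Lk_action :: "complex \<Rightarrow> gen \<Rightarrow> complex poly" where
  "Lk_action k X = (case X of Lg \<Rightarrow> [:k:] | _ \<Rightarrow> 0)"

lemma Ek_smul: "smul (Ek \<alpha> \<beta> \<gamma> \<eta> k) a (q, s) = (smult a q, a * s)"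
  by (simp add: Ek_def)

lemma Ek_dop: "dop (Ek \<alpha> \<beta> \<gamma> \<eta> k) (q, s) = (pCons 0 q + smult s [:k:], \<eta> * s)"
  by (simp add: Ek_def mult.commute)

lemma Ek_lact:
  "lact (Ek \<alpha> \<beta> \<gamma> \<eta> k) X l (q, s) = (lact (Mmod \<alpha> \<beta> \<gamma>) X l q + smult s (Lk_action k X), 0)"
  by (cases X) (simp_all add: Ek_def Mmod_def Lk_action_def mult.commute)

lemma incl_eq: "incl = (\<lambda>x. (x, 0))"
  by (simp add: fun_eq_iff incl_def)

lemma Ek_0_eq_dsum: "Ek \<alpha> \<beta> \<gamma> \<eta> 0 = dsum (Mmod \<alpha> \<beta> \<gamma>) (Cmod \<eta>)"
  unfolding Ek_def dsum_def Mmod_def Cmod_def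
  by (auto simp: fun_eq_iff split: gen.splits)

lemma trivial_ext_iff_equiv_Ek_0:
  "trivial_ext (Mmod \<alpha> \<beta> \<gamma>) (Cmod \<eta>) E i p \<longleftrightarrow> ext_equiv E i p (Ek \<alpha> \<beta> \<gamma> \<eta> 0) incl snd"
  unfolding trivial_ext_def Ek_0_eq_dsum incl_eq ..

text \<open>An equivalence fixes \<open>v\<close> and sends \<open>c\<^sub>\<eta>\<close> to \<open>c\<^sub>\<eta> + q(\<partial>)v\<close>; comparing
  \<open>\<partial>c\<^sub>\<eta>\<close> on both sides gives \<open>k + \<eta>q = \<partial>q + k'\<close>, and evaluation at \<open>\<partial> = \<eta>\<close> yields \<open>k = k'\<close>.\<close>
lemma Ek_equiv_imp_eq:
  assumes "ext_equiv (Ek \<alpha> \<beta> \<gamma> \<eta> k) incl snd (Ek \<alpha> \<beta> \<gamma> \<eta> k') incl snd"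
  shows "k = k'"
proof -
  obtain \<phi> where hom: "chom (Ek \<alpha> \<beta> \<gamma> \<eta> k) (Ek \<alpha> \<beta> \<gamma> \<eta> k') \<phi>"
    and fix_incl: "\<And>x. \<phi> (incl x) = incl x" and fix_snd: "\<And>y. snd (\<phi> y) = snd y"
    using assms unfolding ext_equiv_def by blast
  obtain q where \<phi>_c: "\<phi> (0, 1) = (q, 1)"
    using fix_snd[of "(0, 1)"] by (cases "\<phi> (0, 1)") auto
  have add: "\<And>x y. \<phi> (x + y) = \<phi> x + \<phi> y"
    and smul: "\<And>a x. \<phi> (smul (Ek \<alpha> \<beta> \<gamma> \<eta> k) a x) = smul (Ek \<alpha> \<beta> \<gamma> \<eta> k') a (\<phi> x)"
    and dop: "\<And>w. \<phi> (dop (Ek \<alpha> \<beta> \<gamma> \<eta> k) w) = dop (Ek \<alpha> \<beta> \<gamma> \<eta> k') (\<phi> w)"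
    using hom unfolding chom_def clin_def by auto
  have "\<phi> ([:k:], \<eta>) = \<phi> ([:k:], 0) + \<phi> (0, \<eta>)"
    using add[of "([:k:], 0)" "(0, \<eta>)"] by simp
  also have "\<dots> = ([:k:] + smult \<eta> q, \<eta>)"
    using fix_incl[of "[:k:]"] smul[of \<eta> "(0, 1)"] \<phi>_c by (simp add: incl_def Ek_smul)
  finally have "[:k:] + smult \<eta> q = pCons 0 q + [:k':]"
    using dop[of "(0, 1)"] \<phi>_c by (simp add: Ek_dop)
  then have "poly ([:k:] + smult \<eta> q) \<eta> = poly (pCons 0 q + [:k':]) \<eta>" by simp
  then show ?thesis by simp
qed

lemma Ek_nontrivial:
  assumes "k \<noteq> 0"
  shows "\<not> trivial_ext (Mmod \<alpha> \<beta> \<gamma>) (Cmod \<eta>) (Ek \<alpha> \<beta> \<gamma> \<eta> k) incl snd"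
  using assms Ek_equiv_imp_eq trivial_ext_iff_equiv_Ek_0 by metis

lemma poly_in_lambda_Ek:
  assumes "poly_family h"
  shows "poly_in_lambda (Ek \<alpha> \<beta> \<gamma> \<eta> k) (\<lambda>l. (h l, 0))"
proof -
  obtain Q where Q: "\<And>l. h l = poly Q [:l:]" using assms unfolding poly_family_def by blast
  show ?thesis unfolding poly_in_lambda_def
  proof (intro exI allI)
    fix l
    show "(h l, 0) = (\<Sum>i\<le>degree Q. smul (Ek \<alpha> \<beta> \<gamma> \<eta> k) (l ^ i) (coeff Q i, 0))"
      by (simp add: Ek_def Q poly_const_eq_sum sum_prod)
  qed
qed

lemma poly_in_lambda_lact_Ek: "poly_in_lambda (Ek \<alpha> \<beta> \<gamma> \<eta> k) (\<lambda>l. lact (Ek \<alpha> \<beta> \<gamma> \<eta> k) X l w)"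
proof -
  obtain q s where w: "w = (q, s)" by (cases w)
  have "poly_family (\<lambda>l. lact (Mmod \<alpha> \<beta> \<gamma>) X l q)"
  proof (cases X)
    case Lg
    show ?thesis
      using poly_family_mult[OF poly_family_pcompose_shift[of q] poly_family_linear[of \<alpha> \<beta>]]
      by (simp add: Lg Mmod_def)
  next
    case Yg
    show ?thesis unfolding Yg Mmod_def
      using poly_family_mult[OF poly_family_const[of "[:\<gamma>:]"] poly_family_pcompose_shift[of q]]
      by simp
  next
    case Mg
    show ?thesis unfolding Mg Mmod_def using poly_family_const[of 0] by simp
  qed
  then have "poly_family (\<lambda>l. lact (Mmod \<alpha> \<beta> \<gamma>) X l q + smult s (Lk_action k X))"
    by (intro poly_family_add poly_family_const)
  then show ?thesis using poly_in_lambda_Ek by (simp add: w Ek_lact)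
qed

lemma is_ext_Ek:
  assumes br: "L_coeff_virasoro br" and "\<alpha> = 1" "\<gamma> = 0" "\<beta> + \<eta> = 0"
  shows "is_ext br (Mmod \<alpha> \<beta> \<gamma>) (Cmod \<eta>) (Ek \<alpha> \<beta> \<gamma> \<eta> k) incl snd"
proof -
  have \<eta>: "\<eta> = - \<beta>" using assms by (simp add: eq_neg_iff_add_eq_0 add.commute)
  have LL: "br Lg Lg l n Lg = - n + 2 * l"
    and not_LL: "(X, Z) \<noteq> (Lg, Lg) \<Longrightarrow> br X Z l n Lg = 0" for X Z l n
    using br unfolding L_coeff_virasoro_def by auto
  let ?E = "Ek \<alpha> \<beta> \<gamma> \<eta> k"
  have "conf_module br ?E"
    unfolding conf_module_def
  proof (intro conjI allI)
    show "vec_space ?E"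
      unfolding vec_space_def Ek_def by (auto simp: algebra_simps smult_add_left smult_add_right)
    show "clin ?E ?E (dop ?E)"
      unfolding clin_def Ek_def by (auto simp: algebra_simps smult_add_right)
    show "clin ?E ?E (lact ?E X l)" for X l
      unfolding clin_def Ek_def
      by (auto simp: algebra_simps smult_add_right pcompose_add pcompose_smult split: gen.splits)
    show "poly_in_lambda ?E (\<lambda>l. lact ?E X l w)" for X w
      by (rule poly_in_lambda_lact_Ek)
    show "lact ?E X l (dop ?E w) = dop ?E (lact ?E X l w) + smul ?E l (lact ?E X l w)" for X l w
      using assms \<eta> by (cases w; cases X)
        (simp_all add: Ek_def poly_eq_poly_eq_iff[symmetric] fun_eq_iff poly_pcompose algebra_simps)
    show "lact ?E X l (lact ?E Z m w) - lact ?E Z m (lact ?E X l w) =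
          smul ?E (br X Z l (l + m) Lg) (lact ?E Lg (l + m) w) +
          smul ?E (br X Z l (l + m) Yg) (lact ?E Yg (l + m) w) +
          smul ?E (br X Z l (l + m) Mg) (lact ?E Mg (l + m) w)" for X Z l m w
    proof (cases "(X, Z) = (Lg, Lg)")
      case True
      then show ?thesis using assms \<eta>
        by (cases w) (simp add: LL Ek_def poly_eq_poly_eq_iff[symmetric] fun_eq_iff poly_pcompose
            algebra_simps)
    next
      case False
      then show ?thesis using not_LL[OF False] assms
        by (cases w; cases X; cases Z) (simp_all add: Ek_def zero_prod_def)
    qed
  qed
  moreover have "chom (Mmod \<alpha> \<beta> \<gamma>) ?E incl"
    unfolding chom_def clin_def by (auto simp: incl_def Mmod_def Ek_def split: gen.splits)
  moreover have "chom ?E (Cmod \<eta>) snd"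
    unfolding chom_def clin_def by (auto simp: Cmod_def Ek_def split: gen.splits)
  moreover have "inj incl" by (simp add: inj_def incl_def)
  moreover have "surj (snd :: complex poly \<times> complex \<Rightarrow> complex)" by (metis snd_conv surjI)
  moreover have "range incl = {x. snd x = 0}" by (auto simp: incl_def image_def)
  ultimately show ?thesis unfolding is_ext_def by blast
qed

lemma additive_diff:
  fixes f :: "'a::ab_group_add \<Rightarrow> 'b::ab_group_add"
  assumes "\<And>x y. f (x + y) = f x + f y"
  shows "f (x - y) = f x - f y"
  using assms[of "x - y" y] by (simp add: algebra_simps)

locale Cmod_extension =
  fixes br :: bracket and \<alpha> \<beta> \<gamma> \<eta> :: complex
    and E :: "'e::ab_group_add cmod" and i :: "complex poly \<Rightarrow> 'e" and p :: "'e \<Rightarrow> complex"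
  assumes ext: "is_ext br (Mmod \<alpha> \<beta> \<gamma>) (Cmod \<eta>) E i p"
begin

lemma
  shows E_smul_add: "smul E a (x + y) = smul E a x + smul E a y"
    and E_smul_add_left: "smul E (a + b) x = smul E a x + smul E b x"
    and E_smul_smul: "smul E a (smul E b x) = smul E (a * b) x"
    and E_dop_add: "dop E (x + y) = dop E x + dop E y"
    and E_dop_smul: "dop E (smul E a x) = smul E a (dop E x)"
    and E_lact_add: "lact E X l (x + y) = lact E X l x + lact E X l y"
    and E_lact_smul: "lact E X l (smul E a x) = smul E a (lact E X l x)"
    and E_lact_dop: "lact E X l (dop E x) = dop E (lact E X l x) + smul E l (lact E X l x)"
  using ext unfolding is_ext_def conf_module_def vec_space_def clin_def by auto

lemma
  shows i_add: "i (f + g) = i f + i g"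
    and i_smult: "i (smult a f) = smul E a (i f)"
    and i_pCons: "i (pCons 0 f) = dop E (i f)"
    and i_lact: "i (lact (Mmod \<alpha> \<beta> \<gamma>) X l f) = lact E X l (i f)"
  using ext unfolding is_ext_def chom_def clin_def by (auto simp: Mmod_def)

lemma i_inject: "i f = i g \<longleftrightarrow> f = g"
  using ext unfolding is_ext_def by (auto dest: injD)

lemma
  shows p_add: "p (x + y) = p x + p y"
    and p_smul: "p (smul E a x) = a * p x"
    and p_dop: "p (dop E x) = \<eta> * p x"
    and p_lact: "p (lact E X l x) = 0"
    and p_i: "p (i f) = 0"
  using ext unfolding is_ext_def chom_def clin_def by (auto simp: Cmod_def)

lemma E_smul_diff: "smul E a (x - y) = smul E a x - smul E a y"
  by (rule additive_diff) (rule E_smul_add)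

lemma E_smul_zero: "smul E 0 x = 0"
  using E_smul_add_left[of 0 0 x] by simp

lemma E_dop_diff: "dop E (x - y) = dop E x - dop E y"
  by (rule additive_diff) (rule E_dop_add)

lemma E_lact_diff: "lact E X l (x - y) = lact E X l x - lact E X l y"
  by (rule additive_diff) (rule E_lact_add)

lemma i_diff: "i (f - g) = i f - i g"
  by (rule additive_diff) (rule i_add)

lemma p_diff: "p (x - y) = p x - p y"
  by (rule additive_diff) (rule p_add)

lemma i_inv: "p x = 0 \<Longrightarrow> i (inv i x) = x"
  using ext unfolding is_ext_def by (metis (mono_tags, lifting) f_inv_into_f mem_Collect_eq)

lemma normalized_lift:
  obtains c k where "p c = 1" and "dop E c = smul E \<eta> c + i [:k:]"
proof -
  obtain c0 where c0: "p c0 = 1"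
    using ext unfolding is_ext_def by (metis surjD)
  define f where "f = inv i (dop E c0 - smul E \<eta> c0)"
  have i_f: "i f = dop E c0 - smul E \<eta> c0"
    unfolding f_def by (rule i_inv) (simp add: p_diff p_dop p_smul c0)
  define k where "k = poly f \<eta>"
  define q where "q = synthetic_div f \<eta>"
  have "[:-\<eta>, 1:] * q + [:k:] = f"
    unfolding q_def k_def by (rule synthetic_div_correct')
  then have f_eq: "f - pCons 0 q + smult \<eta> q = [:k:]"
    by (auto simp: poly_eq_poly_eq_iff[symmetric] fun_eq_iff algebra_simps)
  define c where "c = c0 - i q"
  have "p c = 1" by (simp add: c_def p_diff p_i c0)
  moreover have "dop E c = smul E \<eta> c + i [:k:]"
  proof -
    have "i [:k:] = i f - i (pCons 0 q) + i (smult \<eta> q)"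
      by (simp add: f_eq[symmetric] i_diff i_add)
    also have "\<dots> = dop E c0 - smul E \<eta> c0 - dop E (i q) + smul E \<eta> (i q)"
      by (simp add: i_f i_pCons i_smult)
    finally show ?thesis by (simp add: c_def E_dop_diff E_smul_diff algebra_simps)
  qed
  ultimately show ?thesis by (rule that)
qed

lemma lact_lift:
  assumes dop_c: "dop E c = smul E \<eta> c + i [:k:]"
  obtains g where "i g = lact E X l c" and "[:l - \<eta>, 1:] * g = lact (Mmod \<alpha> \<beta> \<gamma>) X l [:k:]"
proof -
  define g where "g = inv i (lact E X l c)"
  have i_g: "i g = lact E X l c" unfolding g_def by (rule i_inv) (rule p_lact)
  have "i (smult \<eta> g + lact (Mmod \<alpha> \<beta> \<gamma>) X l [:k:]) = i (pCons 0 g + smult l g)"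
    using E_lact_dop[of X l c]
    by (simp add: i_add i_smult i_pCons i_lact i_g dop_c E_lact_add E_lact_smul)
  then have "smult \<eta> g + lact (Mmod \<alpha> \<beta> \<gamma>) X l [:k:] = pCons 0 g + smult l g"
    by (simp only: i_inject)
  then have "[:l - \<eta>, 1:] * g = lact (Mmod \<alpha> \<beta> \<gamma>) X l [:k:]"
    by (auto simp: poly_eq_poly_eq_iff[symmetric] fun_eq_iff algebra_simps)
  with i_g show ?thesis by (rule that)
qed

lemma lact_lift_root:
  assumes "dop E c = smul E \<eta> c + i [:k:]"
  shows "poly (lact (Mmod \<alpha> \<beta> \<gamma>) X l [:k:]) (\<eta> - l) = 0"
proof -
  obtain g where "[:l - \<eta>, 1:] * g = lact (Mmod \<alpha> \<beta> \<gamma>) X l [:k:]"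
    using lact_lift[OF assms] .
  from this[symmetric] show ?thesis by (simp add: algebra_simps)
qed

lemma lift_constant_conditions:
  assumes "dop E c = smul E \<eta> c + i [:k:]" and "k \<noteq> 0"
  shows "\<alpha> = 1 \<and> \<beta> + \<eta> = 0 \<and> \<gamma> = 0"
proof -
  have L: "k * (\<alpha> * t + \<beta> + \<eta> - t) = 0" for t
    using lact_lift_root[OF assms(1), of Lg t] by (simp add: Mmod_def algebra_simps)
  have "(\<beta> + \<eta>) * k = 0" and "(\<alpha> - 1) * k = 0"
    using L[of 0] L[of 1] by (simp_all add: algebra_simps)
  moreover have "\<gamma> * k = 0"
    using lact_lift_root[OF assms(1), of Yg 0] by (simp add: Mmod_def)
  ultimately show ?thesis using assms(2) by simp
qed

lemma lact_lift_eq: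
  assumes dop_c: "dop E c = smul E \<eta> c + i [:k:]"
  shows "lact E X l c = i (Lk_action k X)"
proof -
  obtain g where i_g: "i g = lact E X l c" and g: "[:l - \<eta>, 1:] * g = lact (Mmod \<alpha> \<beta> \<gamma>) X l [:k:]"
    using lact_lift[OF dop_c] .
  have "lact (Mmod \<alpha> \<beta> \<gamma>) X l [:k:] = [:l - \<eta>, 1:] * Lk_action k X"
  proof (cases "k = 0")
    case True
    then show ?thesis by (cases X) (simp_all add: Mmod_def Lk_action_def)
  next
    case False
    then have "\<alpha> = 1" "\<beta> = - \<eta>" "\<gamma> = 0"
      using lift_constant_conditions[OF dop_c] by (auto simp: eq_neg_iff_add_eq_0)
    then show ?thesis by (cases X) (simp_all add: Mmod_def Lk_action_def mult.commute)
  qed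
  with g have "[:l - \<eta>, 1:] * g = [:l - \<eta>, 1:] * Lk_action k X" by (rule trans)
  then have "g = Lk_action k X" by (simp only: mult_cancel_left) simp
  with i_g show ?thesis by simp
qed

lemma splitting_retraction:
  assumes "p c = 1"
  obtains r where "\<And>e. i (r e) = e - smul E (p e) c"
proof
  show "i (inv i (e - smul E (p e) c)) = e - smul E (p e) c" for e
    by (rule i_inv) (simp add: p_diff p_smul assms)
qed

lemma chom_splitting:
  assumes dop_c: "dop E c = smul E \<eta> c + i [:k:]"
    and i_r: "\<And>e. i (r e) = e - smul E (p e) c"
  shows "chom E (Ek \<alpha> \<beta> \<gamma> \<eta> k) (\<lambda>e. (r e, p e))"
proof -
  have r_eqI: "r e = f" if "i f = e - smul E (p e) c" for e f
    using i_r[of e] that by (metis i_inject)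
  show ?thesis
    unfolding chom_def clin_def
  proof (intro conjI allI)
    fix x y
    have "r (x + y) = r x + r y"
      by (rule r_eqI) (simp add: i_add i_r p_add E_smul_add_left algebra_simps)
    then show "(r (x + y), p (x + y)) = (r x, p x) + (r y, p y)" by (simp add: p_add)
  next
    fix a x
    have "r (smul E a x) = smult a (r x)"
      by (rule r_eqI) (simp add: i_smult i_r p_smul E_smul_diff E_smul_smul)
    then show "(r (smul E a x), p (smul E a x)) = smul (Ek \<alpha> \<beta> \<gamma> \<eta> k) a (r x, p x)"
      by (simp add: p_smul Ek_smul)
  next
    fix w
    have "i (pCons 0 (r w) + smult (p w) [:k:]) = dop E (w - smul E (p w) c) + smul E (p w) (i [:k:])"
      by (simp only: i_add i_pCons i_smult i_r)
    also have "\<dots> = dop E w - smul E (p (dop E w)) c"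
      by (simp add: E_dop_diff E_dop_smul dop_c E_smul_add E_smul_smul p_dop mult.commute)
    finally have "r (dop E w) = pCons 0 (r w) + smult (p w) [:k:]"
      by (rule r_eqI)
    then show "(r (dop E w), p (dop E w)) = dop (Ek \<alpha> \<beta> \<gamma> \<eta> k) (r w, p w)"
      by (simp add: p_dop Ek_dop)
  next
    fix X l w
    have "i (lact (Mmod \<alpha> \<beta> \<gamma>) X l (r w) + smult (p w) (Lk_action k X)) =
        lact E X l (w - smul E (p w) c) + smul E (p w) (lact E X l c)"
      by (simp add: i_add i_lact i_smult i_r lact_lift_eq[OF dop_c])
    also have "\<dots> = lact E X l w - smul E (p (lact E X l w)) c"
      by (simp add: E_lact_diff E_lact_smul p_lact E_smul_zero)
    finally have "r (lact E X l w) = lact (Mmod \<alpha> \<beta> \<gamma>) X l (r w) + smult (p w) (Lk_action k X)"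
      by (rule r_eqI)
    then show "(r (lact E X l w), p (lact E X l w)) = lact (Ek \<alpha> \<beta> \<gamma> \<eta> k) X l (r w, p w)"
      by (simp add: p_lact Ek_lact)
  qed
qed

lemma equiv_Ek:
  assumes p_c: "p c = 1" and dop_c: "dop E c = smul E \<eta> c + i [:k:]"
  shows "ext_equiv E i p (Ek \<alpha> \<beta> \<gamma> \<eta> k) incl snd"
proof -
  obtain r where i_r: "\<And>e. i (r e) = e - smul E (p e) c"
    using splitting_retraction[OF p_c] by blast
  have "r (i f) = f" for f
    using i_r[of "i f"] by (simp add: p_i E_smul_zero i_inject)
  then show ?thesis
    unfolding ext_equiv_def using chom_splitting[OF dop_c i_r]
    by (auto simp: incl_def p_i)
qed

end

lemma ext_equiv_some_Ek_cases:
  assumes "is_ext br (Mmod \<alpha> \<beta> \<gamma>) (Cmod \<eta>) E i p"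
  obtains k where "ext_equiv E i p (Ek \<alpha> \<beta> \<gamma> \<eta> k) incl snd"
    and "k \<noteq> 0 \<Longrightarrow> \<alpha> = 1 \<and> \<beta> + \<eta> = 0 \<and> \<gamma> = 0"
proof -
  interpret Cmod_extension br \<alpha> \<beta> \<gamma> \<eta> E i p
    by (rule Cmod_extension.intro) (rule assms)
  obtain c k where "p c = 1" and "dop E c = smul E \<eta> c + i [:k:]"
    by (rule normalized_lift)
  with that show ?thesis using equiv_Ek lift_constant_conditions by blast
qed

lemma ext_equiv_some_Ek:
  "is_ext br (Mmod \<alpha> \<beta> \<gamma>) (Cmod \<eta>) E i p \<Longrightarrow> \<exists>k. ext_equiv E i p (Ek \<alpha> \<beta> \<gamma> \<eta> k) incl snd"
  by (metis ext_equiv_some_Ek_cases)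

lemma nontrivial_ext_equiv_Ek:
  assumes "is_ext br (Mmod \<alpha> \<beta> \<gamma>) (Cmod \<eta>) E i p"
    and "\<not> trivial_ext (Mmod \<alpha> \<beta> \<gamma>) (Cmod \<eta>) E i p"
  shows "\<exists>k. k \<noteq> 0 \<and> ext_equiv E i p (Ek \<alpha> \<beta> \<gamma> \<eta> k) incl snd"
  using ext_equiv_some_Ek[OF assms(1)] assms(2) trivial_ext_iff_equiv_Ek_0 by metis

lemma nontrivial_ext_conditions:
  assumes "is_ext br (Mmod \<alpha> \<beta> \<gamma>) (Cmod \<eta>) E i p"
    and "\<not> trivial_ext (Mmod \<alpha> \<beta> \<gamma>) (Cmod \<eta>) E i p"
  shows "\<alpha> = 1 \<and> \<beta> + \<eta> = 0 \<and> \<gamma> = 0"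
proof -
  obtain k where "ext_equiv E i p (Ek \<alpha> \<beta> \<gamma> \<eta> k) incl snd"
    and "k \<noteq> 0 \<Longrightarrow> \<alpha> = 1 \<and> \<beta> + \<eta> = 0 \<and> \<gamma> = 0"
    using ext_equiv_some_Ek_cases[OF assms(1)] by blast
  with assms(2) show ?thesis using trivial_ext_iff_equiv_Ek_0 by metis
qed

lemma exists_nontrivial_ext:
  assumes "L_coeff_virasoro br" and "\<alpha> = 1" and "\<gamma> = 0" and "\<beta> + \<eta> = 0"
  shows "\<exists>(E :: (complex poly \<times> complex) cmod) i p.
    is_ext br (Mmod \<alpha> \<beta> \<gamma>) (Cmod \<eta>) E i p \<and> \<not> trivial_ext (Mmod \<alpha> \<beta> \<gamma>) (Cmod \<eta>) E i p"
  using is_ext_Ek[OF assms, of 1] Ek_nontrivial[OF one_neq_zero] by blast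

text \<open>The hypotheses \<open>\<alpha> \<noteq> 0\<close>, \<open>(a, b) \<noteq> (1, 0)\<close> and \<open>(\<alpha>, \<gamma>) \<noteq> (0, 0)\<close> only make the modules
  \<open>M\<close> irreducible; the classification does not need them.\<close>
theorem theorem4p6:
  fixes \<alpha> \<beta> \<eta> :: complex
  shows
  "(\<forall>a b. (a, b) \<noteq> (1, 0) \<longrightarrow> \<alpha> \<noteq> 0 \<longrightarrow>
      (\<forall>(E::'e::ab_group_add cmod) i p.
          is_ext (TSV_ab a b) (Mmod \<alpha> \<beta> 0) (Cmod \<eta>) E i p \<and>
          \<not> trivial_ext (Mmod \<alpha> \<beta> 0) (Cmod \<eta>) E i p \<longrightarrow> \<beta> + \<eta> = 0 \<and> \<alpha> = 1) \<and>
      (\<beta> + \<eta> = 0 \<and> \<alpha> = 1 \<longrightarrow>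
          (\<exists>(E::(complex poly \<times> complex) cmod) i p.
             is_ext (TSV_ab a b) (Mmod \<alpha> \<beta> 0) (Cmod \<eta>) E i p \<and>
             \<not> trivial_ext (Mmod \<alpha> \<beta> 0) (Cmod \<eta>) E i p)) \<and>
      (\<beta> + \<eta> = 0 \<and> \<alpha> = 1 \<longrightarrow>
          (\<forall>k. k \<noteq> 0 \<longrightarrow>
             is_ext (TSV_ab a b) (Mmod \<alpha> \<beta> 0) (Cmod \<eta>) (Ek \<alpha> \<beta> 0 \<eta> k) incl snd \<and>
             \<not> trivial_ext (Mmod \<alpha> \<beta> 0) (Cmod \<eta>) (Ek \<alpha> \<beta> 0 \<eta> k) incl snd) \<and>
          (\<forall>(E::'e cmod) i p. is_ext (TSV_ab a b) (Mmod \<alpha> \<beta> 0) (Cmod \<eta>) E i p \<longrightarrow>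
             (\<exists>k. ext_equiv E i p (Ek \<alpha> \<beta> 0 \<eta> k) incl snd)) \<and>
          (\<forall>(E::'e cmod) i p. is_ext (TSV_ab a b) (Mmod \<alpha> \<beta> 0) (Cmod \<eta>) E i p \<and>
             \<not> trivial_ext (Mmod \<alpha> \<beta> 0) (Cmod \<eta>) E i p \<longrightarrow>
             (\<exists>k. k \<noteq> 0 \<and> ext_equiv E i p (Ek \<alpha> \<beta> 0 \<eta> k) incl snd)) \<and>
          (\<forall>k k'. ext_equiv (Ek \<alpha> \<beta> 0 \<eta> k) incl snd (Ek \<alpha> \<beta> 0 \<eta> k') incl snd \<longrightarrow> k = k')))
   \<and>
   (\<forall>\<gamma>. (\<alpha>, \<gamma>) \<noteq> (0, 0) \<longrightarrow>
      (\<forall>(E::'e cmod) i p.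
          is_ext (TSV_ab 1 0) (Mmod \<alpha> \<beta> \<gamma>) (Cmod \<eta>) E i p \<and>
          \<not> trivial_ext (Mmod \<alpha> \<beta> \<gamma>) (Cmod \<eta>) E i p \<longrightarrow> \<beta> + \<eta> = 0 \<and> (\<alpha>, \<gamma>) = (1, 0)) \<and>
      (\<beta> + \<eta> = 0 \<and> (\<alpha>, \<gamma>) = (1, 0) \<longrightarrow>
          (\<exists>(E::(complex poly \<times> complex) cmod) i p.
             is_ext (TSV_ab 1 0) (Mmod \<alpha> \<beta> \<gamma>) (Cmod \<eta>) E i p \<and>
             \<not> trivial_ext (Mmod \<alpha> \<beta> \<gamma>) (Cmod \<eta>) E i p)) \<and>
      (\<beta> + \<eta> = 0 \<and> (\<alpha>, \<gamma>) = (1, 0) \<longrightarrow>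
          (\<forall>k. k \<noteq> 0 \<longrightarrow>
             is_ext (TSV_ab 1 0) (Mmod \<alpha> \<beta> \<gamma>) (Cmod \<eta>) (Ek \<alpha> \<beta> \<gamma> \<eta> k) incl snd \<and>
             \<not> trivial_ext (Mmod \<alpha> \<beta> \<gamma>) (Cmod \<eta>) (Ek \<alpha> \<beta> \<gamma> \<eta> k) incl snd) \<and>
          (\<forall>(E::'e cmod) i p. is_ext (TSV_ab 1 0) (Mmod \<alpha> \<beta> \<gamma>) (Cmod \<eta>) E i p \<longrightarrow>
             (\<exists>k. ext_equiv E i p (Ek \<alpha> \<beta> \<gamma> \<eta> k) incl snd)) \<and>
          (\<forall>(E::'e cmod) i p. is_ext (TSV_ab 1 0) (Mmod \<alpha> \<beta> \<gamma>) (Cmod \<eta>) E i p \<and>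
             \<not> trivial_ext (Mmod \<alpha> \<beta> \<gamma>) (Cmod \<eta>) E i p \<longrightarrow>
             (\<exists>k. k \<noteq> 0 \<and> ext_equiv E i p (Ek \<alpha> \<beta> \<gamma> \<eta> k) incl snd)) \<and>
          (\<forall>k k'. ext_equiv (Ek \<alpha> \<beta> \<gamma> \<eta> k) incl snd (Ek \<alpha> \<beta> \<gamma> \<eta> k') incl snd \<longrightarrow> k = k')))
   \<and>
   (\<forall>c. \<alpha> \<noteq> 0 \<longrightarrow>
      (\<forall>(E::'e cmod) i p.
          is_ext (TSV_c c) (Mmod \<alpha> \<beta> 0) (Cmod \<eta>) E i p \<and>
          \<not> trivial_ext (Mmod \<alpha> \<beta> 0) (Cmod \<eta>) E i p \<longrightarrow> \<beta> + \<eta> = 0 \<and> \<alpha> = 1) \<and>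
      (\<beta> + \<eta> = 0 \<and> \<alpha> = 1 \<longrightarrow>
          (\<exists>(E::(complex poly \<times> complex) cmod) i p.
             is_ext (TSV_c c) (Mmod \<alpha> \<beta> 0) (Cmod \<eta>) E i p \<and>
             \<not> trivial_ext (Mmod \<alpha> \<beta> 0) (Cmod \<eta>) E i p)) \<and>
      (\<beta> + \<eta> = 0 \<and> \<alpha> = 1 \<longrightarrow>
          (\<forall>k. k \<noteq> 0 \<longrightarrow>
             is_ext (TSV_c c) (Mmod \<alpha> \<beta> 0) (Cmod \<eta>) (Ek \<alpha> \<beta> 0 \<eta> k) incl snd \<and>
             \<not> trivial_ext (Mmod \<alpha> \<beta> 0) (Cmod \<eta>) (Ek \<alpha> \<beta> 0 \<eta> k) incl snd) \<and>
          (\<forall>(E::'e cmod) i p. is_ext (TSV_c c) (Mmod \<alpha> \<beta> 0) (Cmod \<eta>) E i p \<longrightarrow>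
             (\<exists>k. ext_equiv E i p (Ek \<alpha> \<beta> 0 \<eta> k) incl snd)) \<and>
          (\<forall>(E::'e cmod) i p. is_ext (TSV_c c) (Mmod \<alpha> \<beta> 0) (Cmod \<eta>) E i p \<and>
             \<not> trivial_ext (Mmod \<alpha> \<beta> 0) (Cmod \<eta>) E i p \<longrightarrow>
             (\<exists>k. k \<noteq> 0 \<and> ext_equiv E i p (Ek \<alpha> \<beta> 0 \<eta> k) incl snd)) \<and>
          (\<forall>k k'. ext_equiv (Ek \<alpha> \<beta> 0 \<eta> k) incl snd (Ek \<alpha> \<beta> 0 \<eta> k') incl snd \<longrightarrow> k = k')))"
  using L_coeff_virasoro_TSV_ab L_coeff_virasoro_TSV_c
  by (intro conjI allI impI; (elim conjE)?)
    (auto simp: Ek_nontrivial intro: exists_nontrivial_ext is_ext_Ek nontrivial_ext_equiv_Ek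
      ext_equiv_some_Ek dest: nontrivial_ext_conditions Ek_equiv_imp_eq)

end
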